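(* Consider an open network of $J$ nodes, each an infinite-server ($M|G|\infty$) node, with exogenous Poisson arrival rates $\lambda_1,\dots,\lambda_J\ge 0$, $\lambda=\sum_{j=1}^J\lambda_j>0$, commutation (routing) matrix $P=[p_{jl}]_{j,l=1}^J$ such that $I-P$ is invertible, and service time distribution function $G_j$ at node $j$, as described in the context. Let $S$ be the sojourn time of a customer in the network (the total service time received by the customer from its entrance into the network until its departure), let $\bar G(s)$ be the Laplace transform of the distribution of $S$, and let $\bar G_j(s)$ be the Laplace transform of the service time distribution at node $j$. Define the column vector and the matrix $$\Lambda(s)=\begin{bmatrix}\lambda_1\bar G_1(s)\\ \lambda_2\bar G_2(s)\\ \vdots\\ \lambda_J\bar G_J(s)\end{bmatrix},\qquad P(s)=\bigl[p_{jl}\,\bar G_l(s)\bigr]_{j,l=1}^{J}.$$ Then, for every $s\ge 0$, the matrix $I-P(s)$ is invertible and $$\bar G(s)=\lambda^{-1}\,\Lambda^T(s)\,\bigl(I-P(s)\bigr)^{-1}(I-P)\,A,$$ where $I$ is the $J\times J$ identity matrix and $A$ is the column vector with $J$ entries all equal to $1$.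
   Context: Network model. There are $J$ nodes. Customers arrive from outside at node $j$ according to a Poisson process of rate $\lambda_j$ (independently over $j$), so that a customer entering the network enters at node $j$ with probability $\lambda_j/\lambda$, where $\lambda=\sum_{j=1}^J\lambda_j$. Each node has infinitely many servers, so a customer arriving at a node immediately starts service there; travel between nodes is instantaneous. Service times at node $j$ are nonnegative random variables $S_j$ with distribution function $G_j$; the service times at the successive nodes visited by a customer (including repeated visits to the same node) are independent of each other and of the customer's route. Routing (commutation process). After ending its service at node $j$, a customer goes to node $l$ with probability $p_{jl}\ge 0$, independently of the past, and leaves the network with probability $q_j=1-\sum_{l=1}^J p_{jl}\ge 0$. The matrix $P=[p_{jl}]$ is the commutation process matrix. The network is open: customers may enter and leave it, and $I-P$ is invertible (equivalently, every customer eventually leaves with probability one). Laplace transforms. For a nonnegative random variable $X$ with distribution function $F$, the Laplace transform of its distribution is $\bar F(s)=E[e^{-sX}]=\int_{[0,\infty)}e^{-st}\,dF(t)$, $s\ge 0$. The distribution function of $S$ is denoted $G$ and its transform $\bar G(s)$; the transform of $G_j$ is $\bar G_j(s)$. *)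

theory Defs
  imports "HOL-Probability.Probability"
begin

text \<open>A customer's position after \<open>k\<close> service completions is an element of \<^typ>\<open>'n option\<close>:
  \<open>Some j\<close> is node \<open>j\<close>, and \<open>None\<close>, the outside of the network, is absorbing.\<close>

definition exit_prob :: "real^'n^'n \<Rightarrow> 'n \<Rightarrow> real" where
  "exit_prob P j = 1 - (\<Sum>l\<in>UNIV. P $ j $ l)"

fun routing_prob :: "real^'n^'n \<Rightarrow> 'n option \<Rightarrow> 'n option \<Rightarrow> real" where
  "routing_prob P (Some j) (Some l) = P $ j $ l"
| "routing_prob P (Some j) None = exit_prob P j"
| "routing_prob P None (Some l) = 0"
| "routing_prob P None None = 1"

definition total_rate :: "real^'n \<Rightarrow> real" where
  "total_rate lam = (\<Sum>j\<in>UNIV. lam $ j)"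

text \<open>An entering customer of an open network of infinite-server nodes. Customers never wait and
  do not interact, so the arrival rates matter only through the entry probabilities
  \<open>\<lambda>\<^sub>j / \<lambda>\<close>. The variable \<open>serv k j\<close> is the time the customer spends in its
  \<open>k\<close>-th service (counted from 0) if that service is at node \<open>j\<close>; a fresh variable for each \<open>k\<close>
  makes repeated visits to a node independent.\<close>

locale infinite_server_network = prob_space M
  for M :: "'a measure"
    and lam :: "real^'n"
    and P :: "real^'n^'n"
    and G :: "'n \<Rightarrow> real \<Rightarrow> real"
    and route :: "nat \<Rightarrow> 'a \<Rightarrow> 'n option"
    and serv :: "nat \<Rightarrow> 'n \<Rightarrow> 'a \<Rightarrow> real" +
  assumes rate_nonneg: "0 \<le> lam $ j"
    and total_rate_pos: "0 < total_rate lam"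
    and routing_nonneg: "0 \<le> P $ j $ l"
    and exit_nonneg: "0 \<le> exit_prob P j"
    and open_network: "invertible (mat 1 - P)"
    and route_measurable: "route k \<in> measurable M (count_space UNIV)"
    and entry: "prob {\<omega> \<in> space M. route 0 \<omega> = Some j} = lam $ j / total_rate lam"
    and routing:
      "prob {\<omega> \<in> space M. (\<forall>i\<le>n. route i \<omega> = x i) \<and> route (Suc n) \<omega> = y} =
        prob {\<omega> \<in> space M. \<forall>i\<le>n. route i \<omega> = x i} * routing_prob P (x n) y"
    and service_measurable: "serv k j \<in> borel_measurable M"
    and service_nonneg: "AE \<omega> in M. 0 \<le> serv k j \<omega>"
    and service_cdf: "cdf (distr M borel (serv k j)) = G j"
    and services_indep: "indep_vars (\<lambda>_. borel) (\<lambda>(k, j). serv k j) UNIV"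
    and services_indep_route:
      "indep_set
        (sets (vimage_algebra (space M) (\<lambda>\<omega> k. route k \<omega>)
          (\<Pi>\<^sub>M k\<in>UNIV. count_space UNIV)))
        (sets (vimage_algebra (space M) (\<lambda>\<omega> (k, j). serv k j \<omega>)
          (\<Pi>\<^sub>M kj\<in>UNIV. borel)))"

text \<open>Almost surely only finitely many terms of this series are nonzero.\<close>

definition sojourn_time ::
    "(nat \<Rightarrow> 'a \<Rightarrow> 'n option) \<Rightarrow> (nat \<Rightarrow> 'n \<Rightarrow> 'a \<Rightarrow> real) \<Rightarrow> 'a \<Rightarrow> real" where
  "sojourn_time route serv \<omega> =
    (\<Sum>k. case route k \<omega> of None \<Rightarrow> 0 | Some j \<Rightarrow> serv k j \<omega>)"

lemma (in infinite_server_network) sojourn_time_measurable: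
  "sojourn_time route serv \<in> borel_measurable M"
proof -
  have [measurable]: "route k \<in> measurable M (count_space UNIV)" for k
    by (rule route_measurable)
  have [measurable]: "serv k j \<in> borel_measurable M" for k j
    by (rule service_measurable)
  have "(\<lambda>\<omega>. case route k \<omega> of None \<Rightarrow> 0 | Some j \<Rightarrow> serv k j \<omega>) =
      (\<lambda>\<omega>. \<Sum>j\<in>UNIV. if route k \<omega> = Some j then serv k j \<omega> else 0)" for k
    by (auto simp: fun_eq_iff split: option.split)
  then have [measurable]:
      "(\<lambda>\<omega>. case route k \<omega> of None \<Rightarrow> 0 | Some j \<Rightarrow> serv k j \<omega>) \<in> borel_measurable M" for k
    by simp
  show ?thesis
    unfolding sojourn_time_def by measurable
qed

text \<open>The Laplace transform of the distribution with distribution function \<open>F\<close>: the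
  Lebesgue-Stieltjes integral over the closed half-line, so an atom at 0 counts.\<close>

definition laplace_transform :: "(real \<Rightarrow> real) \<Rightarrow> real \<Rightarrow> real" where
  "laplace_transform F s = (LINT t:{0..}|interval_measure F. exp (- s * t))"

lemma interval_measure_cdf:
  assumes "real_distribution N"
  shows "interval_measure (cdf N) = N"
proof -
  interpret real_distribution N by fact
  have "real_distribution (interval_measure (cdf N))"
    by (intro real_distribution_interval_measure cdf_nondecreasing cdf_is_right_cont
        cdf_lim_at_top_prob cdf_lim_at_bot)
  moreover have "cdf (interval_measure (cdf N)) = cdf N"
    by (intro cdf_interval_measure cdf_nondecreasing cdf_is_right_cont cdf_lim_at_bot)
  ultimately show ?thesis
    using assms by (intro cdf_unique)
qed

lemma (in prob_space) laplace_transform_eq_expectation: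
  assumes X [measurable]: "X \<in> borel_measurable M" and nonneg: "AE \<omega> in M. 0 \<le> X \<omega>"
  shows "laplace_transform (cdf (distr M borel X)) s = expectation (\<lambda>\<omega>. exp (- s * X \<omega>))"
proof -
  have "real_distribution (distr M borel X)"
    by (rule real_distribution_distr) (rule X)
  then have "laplace_transform (cdf (distr M borel X)) s =
      (\<integral>\<omega>. indicator {0..} (X \<omega>) *\<^sub>R exp (- s * X \<omega>) \<partial>M)"
    by (simp add: laplace_transform_def interval_measure_cdf set_lebesgue_integral_def
        integral_distr)
  also have "\<dots> = expectation (\<lambda>\<omega>. exp (- s * X \<omega>))"
    using nonneg by (intro integral_cong_AE) (auto simp: indicator_def)
  finally show ?thesis .
qed

definition Lambda_vec :: "real^'n \<Rightarrow> ('n \<Rightarrow> real \<Rightarrow> real) \<Rightarrow> real \<Rightarrow> real^'n" where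
  "Lambda_vec lam G s = (\<chi> j. lam $ j * laplace_transform (G j) s)"

definition P_mat :: "real^'n^'n \<Rightarrow> ('n \<Rightarrow> real \<Rightarrow> real) \<Rightarrow> real \<Rightarrow> real^'n^'n" where
  "P_mat P G s = (\<chi> j l. P $ j $ l * laplace_transform (G l) s)"

end

theory Submission
  imports Defs
begin

text \<open>For a fixed \<open>s\<close> let \<open>R\<^sub>n\<close> be the expectation of \<open>exp (- s S)\<close> on the event that the customer
  is still in the network after \<open>n\<close> services, and let \<open>F\<^sub>n v\<close> be the expectation, on that event, of
  \<open>v (X\<^sub>n) exp (- s T\<^sub>n)\<close>, where \<open>X\<^sub>n\<close> is the current node and \<open>T\<^sub>n\<close> is the total time of the services
  \<open>0, \<dots>, n\<close>. Conditioning on the route gives \<open>F\<^sub>n\<^sub>+\<^sub>1 v = F\<^sub>n (P(s) v)\<close>, and splitting off the customers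
  who leave after service \<open>n\<close> gives \<open>R\<^sub>n = R\<^sub>n\<^sub>+\<^sub>1 + F\<^sub>n q\<close> with \<open>q = (I - P) A\<close>. If
  \<open>v = (I - P(s))\<^sup>-\<^sup>1 q\<close>, that is \<open>v = P(s) v + q\<close>, then \<open>R\<^sub>n - F\<^sub>n v\<close> does not depend on \<open>n\<close>. Both
  terms tend to 0 because the survival probabilities are governed by \<open>P\<^sup>n A\<close>, so
  \<open>R\<^sub>0 = F\<^sub>0 v\<close>, which is the claim.\<close>

section \<open>Substochastic matrices\<close>

lemma matrix_vector_mult_mono:
  fixes P :: "real^'n^'m"
  assumes "\<And>i j. 0 \<le> P $ i $ j" "\<And>j. v $ j \<le> w $ j"
  shows "(P *v v) $ i \<le> (P *v w) $ i"
  by (auto simp: matrix_vector_mult_def intro!: sum_mono mult_left_mono assms)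

text \<open>Row sums at most 1 put \<open>P A\<close> below \<open>A\<close>, the all-ones vector,
  and monotonicity of \<open>P\<close> makes the iterates decrease to a limit. Entry
  \<open>i\<close> is the chance that a customer at node \<open>i\<close> makes at least
  \<open>n\<close> further moves inside the network.\<close>

lemma substochastic_powers_tendsto_0:
  fixes P :: "real^'n^'n"
  assumes nonneg: "\<And>i j. 0 \<le> P $ i $ j"
    and substochastic: "\<And>i. 0 \<le> exit_prob P i"
    and inv: "invertible (mat 1 - P)"
  shows "(\<lambda>n. (((*v) P ^^ n) (\<chi> j. 1)) $ i) \<longlonglongrightarrow> 0"
proof -
  define u where "u n = ((*v) P ^^ n) (\<chi> j. 1)" for n
  have u0: "u 0 = (\<chi> j. 1)" and uS: "u (Suc n) = P *v u n" for n
    by (simp_all add: u_def)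
  have step: "u (Suc n) $ i \<le> u n $ i" for n i
  proof (induction n arbitrary: i)
    case 0
    then show ?case
      using substochastic[of i] unfolding uS u0
      by (simp add: matrix_vector_mult_def exit_prob_def)
  next
    case (Suc n)
    then show ?case
      unfolding uS[of "Suc n"] uS[of n]
      by (intro matrix_vector_mult_mono nonneg) (simp_all flip: uS)
  qed
  have pos: "0 \<le> u n $ i" for n i
  proof (induction n arbitrary: i)
    case (Suc n)
    then show ?case
      by (auto simp: uS matrix_vector_mult_def intro!: sum_nonneg mult_nonneg_nonneg nonneg)
  qed (simp add: u0)
  have "\<exists>l. (\<lambda>n. u n $ i) \<longlonglongrightarrow> l" for i
    using decseq_convergent[of "\<lambda>n. u n $ i" 0] step pos by (metis decseq_Suc_iff)
  then obtain h where h: "(\<lambda>n. u n $ i) \<longlonglongrightarrow> h i" for i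
    by metis
  \<comment> \<open>The limit of the decreasing sequence is a fixed point of \<open>P\<close>, hence 0 since \<open>I - P\<close> is injective.\<close>
  have "(P *v (\<chi> i. h i)) $ i = h i" for i
  proof (rule LIMSEQ_unique)
    show "(\<lambda>n. u (Suc n) $ i) \<longlonglongrightarrow> h i"
      by (rule LIMSEQ_Suc) (rule h)
    show "(\<lambda>n. u (Suc n) $ i) \<longlonglongrightarrow> (P *v (\<chi> i. h i)) $ i"
      unfolding uS by (auto simp: matrix_vector_mult_def intro!: tendsto_intros h)
  qed
  then have "(mat 1 - P) *v (\<chi> i. h i) = 0"
    by (simp add: vec_eq_iff matrix_vector_mult_diff_rdistrib)
  then have "(\<chi> i. h i) = 0"
    using inv matrix_left_invertible_ker[of "mat 1 - P"] invertible_left_inverse by blast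
  then have "h i = 0"
    by (simp add: vec_eq_iff)
  then show ?thesis
    using h[of i] by (simp add: u_def)
qed

text \<open>Meant for \<open>Q\<close> = \<open>P(s)\<close>, whose entries are those of
  \<open>P\<close> scaled by factors between 0 and 1. For a square matrix a trivial kernel is
  enough.\<close>

lemma invertible_dominated_substochastic:
  fixes P Q :: "real^'n^'n"
  assumes nonneg: "\<And>i j. 0 \<le> P $ i $ j"
    and substochastic: "\<And>i. 0 \<le> exit_prob P i"
    and inv: "invertible (mat 1 - P)"
    and dom: "\<And>i j. \<bar>Q $ i $ j\<bar> \<le> P $ i $ j"
  shows "invertible (mat 1 - Q)"
proof -
  have "v = 0" if v: "(mat 1 - Q) *v v = 0" for v
  proof -
    define u where "u n = ((*v) P ^^ n) (\<chi> j. 1)" for n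
    have fixed: "v = Q *v v"
      using v by (simp add: matrix_vector_mult_diff_rdistrib)
    \<comment> \<open>A kernel vector equals \<open>Q\<^sup>n v\<close>, which is dominated by \<open>P\<^sup>n\<close> applied to a constant vector.\<close>
    have "\<bar>v $ i\<bar> \<le> norm v * u n $ i" for n i
    proof (induction n arbitrary: i)
      case 0
      then show ?case
        by (simp add: u_def component_le_norm_cart)
    next
      case (Suc n)
      have "\<bar>v $ i\<bar> = \<bar>\<Sum>j\<in>UNIV. Q $ i $ j * v $ j\<bar>"
        by (subst fixed) (simp add: matrix_vector_mult_def)
      also have "\<dots> \<le> (\<Sum>j\<in>UNIV. P $ i $ j * (norm v * u n $ j))"
        by (rule order_trans[OF sum_abs])
          (auto simp: abs_mult intro!: sum_mono mult_mono dom Suc nonneg)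
      also have "\<dots> = norm v * u (Suc n) $ i"
        by (simp add: u_def matrix_vector_mult_def sum_distrib_left ac_simps)
      finally show ?case .
    qed
    then have "\<bar>v $ i\<bar> \<le> 0" for i
      using tendsto_mult_right_zero[OF
          substochastic_powers_tendsto_0[OF nonneg substochastic inv, of i], of "norm v"]
      by (intro LIMSEQ_le_const[where a = "\<bar>v $ i\<bar>"]) (auto simp: u_def)
    then show ?thesis
      by (simp add: vec_eq_iff)
  qed
  then show ?thesis
    unfolding invertible_left_inverse matrix_left_invertible_ker by blast
qed

lemma matrix_mul_matrix_inv:
  fixes A :: "real^'n^'n"
  assumes "invertible A"
  shows "A ** matrix_inv A = mat 1"
  using someI_ex[OF assms[unfolded invertible_def]] unfolding matrix_inv_def by blast

section \<open>Sums over the possible node sequences\<close>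

text \<open>Fixing the value \<open>undefined\<close> beyond \<open>n\<close> leaves one function
  per node sequence, so the set is finite and sums over it count no sequence twice.\<close>

definition node_paths :: "nat \<Rightarrow> (nat \<Rightarrow> 'n) set" where
  "node_paths n = Pi\<^sub>E {..n} (\<lambda>_. UNIV)"

lemma finite_node_paths [simp]: "finite (node_paths n :: (nat \<Rightarrow> 'n::finite) set)"
  by (simp add: node_paths_def finite_PiE)

lemma sum_node_paths_0:
  fixes f :: "(nat \<Rightarrow> 'n::finite) \<Rightarrow> 'b::comm_monoid_add"
  shows "(\<Sum>x\<in>node_paths 0. f x) = (\<Sum>j\<in>UNIV. f ((\<lambda>_. undefined)(0 := j)))"
proof -
  have "node_paths 0 = (\<lambda>j. (\<lambda>_. undefined)(0 := j)) ` (UNIV :: 'n set)"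
    using PiE_insert_eq[of "0::nat" "{}" "\<lambda>_. UNIV :: 'n set"]
    by (auto simp: node_paths_def atMost_0)
  moreover have "inj (\<lambda>j :: 'n. (\<lambda>_. undefined)(0 := j :: 'n) :: nat \<Rightarrow> 'n)"
    by (rule injI) (metis fun_upd_same)
  ultimately show ?thesis
    by (simp add: sum.reindex)
qed

lemma sum_node_paths_Suc:
  fixes f :: "(nat \<Rightarrow> 'n::finite) \<Rightarrow> 'b::comm_monoid_add"
  shows "(\<Sum>x\<in>node_paths (Suc n). f x) = (\<Sum>x\<in>node_paths n. \<Sum>j\<in>UNIV. f (x(Suc n := j)))"
proof -
  have "(\<Sum>x\<in>node_paths (Suc n). f x) = (\<Sum>(j, x)\<in>UNIV \<times> node_paths n. f (x(Suc n := j)))"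
    unfolding node_paths_def atMost_Suc PiE_insert_eq
    by (subst sum.reindex) (auto simp: inj_combinator[where T = "\<lambda>_. UNIV"] split_beta intro!: sum.cong)
  also have "\<dots> = (\<Sum>x\<in>node_paths n. \<Sum>j\<in>UNIV. f (x(Suc n := j)))"
    by (simp add: sum.swap[of _ UNIV] flip: sum.cartesian_product)
  finally show ?thesis .
qed

text \<open>The locale states independence of route and services for sigma-algebras. It passes to
  variables measurable with respect to them, since these generate sub-sigma-algebras.\<close>

lemma (in prob_space) indep_var_of_indep_set:
  assumes indep: "indep_set (sets N1) (sets N2)"
    and space: "space N1 = space M" "space N2 = space M"
    and X: "X \<in> measurable N1 S" and Y: "Y \<in> measurable N2 T"
  shows "indep_var S X T Y"
  unfolding indep_var_eq
proof (intro conjI)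
  show "random_variable S X"
    using X space indep_setD_ev1[OF indep] by (auto simp: measurable_def)
  show "random_variable T Y"
    using Y space indep_setD_ev2[OF indep] by (auto simp: measurable_def)
  have "sigma_sets (space M) {X -` A \<inter> space M |A. A \<in> sets S} \<subseteq> sets N1"
    using measurable_sets[OF X] sets.top[of N1]
    by (intro sets.sigma_sets_subset'[of _ N1, unfolded space]) (auto simp: space)
  moreover have "sigma_sets (space M) {Y -` A \<inter> space M |A. A \<in> sets T} \<subseteq> sets N2"
    using measurable_sets[OF Y] sets.top[of N2]
    by (intro sets.sigma_sets_subset'[of _ N2, unfolded space]) (auto simp: space)
  ultimately show "indep_set (sigma_sets (space M) {X -` A \<inter> space M |A. A \<in> sets S})
      (sigma_sets (space M) {Y -` A \<inter> space M |A. A \<in> sets T})"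
    using indep unfolding indep_set_def
    by (elim indep_sets_mono_sets) (auto split: bool.split)
qed

section \<open>The route of a customer\<close>

context infinite_server_network
begin

lemma measurable_route [measurable]: "route k \<in> measurable M (count_space UNIV)"
  by (rule route_measurable)

lemma measurable_serv [measurable]: "serv k j \<in> borel_measurable M"
  by (rule service_measurable)

lemma measurable_sojourn_time [measurable]: "sojourn_time route serv \<in> borel_measurable M"
  by (rule sojourn_time_measurable)

definition visits :: "nat \<Rightarrow> (nat \<Rightarrow> 'n) \<Rightarrow> 'a set" where
  "visits n x = {\<omega> \<in> space M. \<forall>i\<le>n. route i \<omega> = Some (x i)}"

text \<open>Demanding a node at every step up to \<open>n\<close>, not only at \<open>n\<close>,
  makes this exactly the disjoint union of \<open>visits n x\<close> over
  \<open>node_paths n\<close>; absorption outside holds only almost surely.\<close>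

definition alive :: "nat \<Rightarrow> 'a set" where
  "alive n = {\<omega> \<in> space M. \<forall>i\<le>n. route i \<omega> \<noteq> None}"

lemma sets_visits [measurable]: "visits n x \<in> sets M"
  unfolding visits_def by measurable

lemma sets_alive [measurable]: "alive n \<in> sets M"
  unfolding alive_def by measurable

lemma prob_visits_Suc:
  "prob (visits (Suc n) (x(Suc n := l))) = prob (visits n x) * P $ x n $ l"
proof -
  have "visits (Suc n) (x(Suc n := l)) =
      {\<omega> \<in> space M. (\<forall>i\<le>n. route i \<omega> = Some (x i)) \<and> route (Suc n) \<omega> = Some l}"
    by (auto simp: visits_def le_Suc_eq)
  then show ?thesis
    using routing[of n "\<lambda>i. Some (x i)" "Some l"] by (simp add: visits_def)
qed

lemma prob_visits_exit:
  "prob (visits n x \<inter> {\<omega> \<in> space M. route (Suc n) \<omega> = None}) =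
    prob (visits n x) * exit_prob P (x n)"
proof -
  have "visits n x \<inter> {\<omega> \<in> space M. route (Suc n) \<omega> = None} =
      {\<omega> \<in> space M. (\<forall>i\<le>n. route i \<omega> = Some (x i)) \<and> route (Suc n) \<omega> = None}"
    by (auto simp: visits_def)
  then show ?thesis
    using routing[of n "\<lambda>i. Some (x i)" None] by (simp add: visits_def)
qed

text \<open>With \<open>g j\<close> the transform of \<open>G j\<close> this is
  \<open>F\<^sub>n v\<close> of the overview; with \<open>g\<close> constantly 1 it serves to
  compute survival probabilities.\<close>

definition path_sum :: "('n \<Rightarrow> real) \<Rightarrow> nat \<Rightarrow> real^'n \<Rightarrow> real" where
  "path_sum g n v = (\<Sum>x\<in>node_paths n. prob (visits n x) * (\<Prod>i\<le>n. g (x i)) * v $ x n)"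

text \<open>Summing out the last node turns its transition probability and its factor
  \<open>g\<close> into one matrix multiplication, by \<open>P(s)\<close> when \<open>g\<close>
  consists of the service transforms.\<close>

lemma path_sum_Suc:
  "path_sum g (Suc n) v = path_sum g n ((\<chi> j l. P $ j $ l * g l) *v v)"
proof -
  have "(\<Prod>i\<le>n. g ((x(Suc n := j)) i)) = (\<Prod>i\<le>n. g (x i))" for x j
    by (intro prod.cong) auto
  then show ?thesis
    by (simp add: path_sum_def sum_node_paths_Suc prob_visits_Suc matrix_vector_mult_def
        sum_distrib_left ac_simps)
qed

lemma path_sum_0: "path_sum g 0 v = (\<Sum>j\<in>UNIV. lam $ j / total_rate lam * g j * v $ j)"
  using entry by (simp add: path_sum_def sum_node_paths_0 visits_def)

lemma path_sum_add: "path_sum g n (v + w) = path_sum g n v + path_sum g n w"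
  by (simp add: path_sum_def distrib_left sum.distrib)

lemma path_sum_one: "path_sum (\<lambda>_. 1) n v = path_sum (\<lambda>_. 1) 0 (((*v) P ^^ n) v)"
proof (induction n arbitrary: v)
  case (Suc n)
  have "(\<chi> j l. P $ j $ l * 1) = P"
    by (simp add: vec_eq_iff)
  then show ?case
    using Suc[of "P *v v"] by (simp add: path_sum_Suc funpow_swap1)
qed simp

text \<open>Bounding the factors \<open>g\<close> by 1 and the entries of \<open>v\<close> by its
  norm leaves only path probabilities, whose sum \<open>prob_alive\<close> identifies as the
  survival probability.\<close>

lemma abs_path_sum_le:
  assumes "\<And>j. 0 \<le> g j" "\<And>j. g j \<le> 1"
  shows "\<bar>path_sum g n v\<bar> \<le> norm v * path_sum (\<lambda>_. 1) n (\<chi> j. 1)"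
proof -
  have "\<bar>prob (visits n x) * (\<Prod>i\<le>n. g (x i)) * v $ x n\<bar> \<le> prob (visits n x) * 1 * norm v" for x
    unfolding abs_mult
    by (intro mult_mono)
      (auto simp: prod_nonneg assms component_le_norm_cart intro!: prod_le_1)
  then show ?thesis
    unfolding path_sum_def sum_distrib_left
    by (intro order_trans[OF sum_abs] sum_mono) (simp add: ac_simps)
qed

lemma indicator_alive:
  "indicator (alive n) \<omega> = (\<Sum>x\<in>node_paths n. indicator (visits n x) \<omega> :: real)"
proof (cases "\<omega> \<in> alive n")
  case True
  \<comment> \<open>The only node sequence compatible with the outcome; the restriction places it in
    \<open>node_paths n\<close>.\<close>
  define y where "y = restrict (\<lambda>i. the (route i \<omega>)) {..n}"
  have "\<omega> \<in> visits n x \<longleftrightarrow> x = y" if "x \<in> node_paths n" for x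
    using that True
    by (auto simp: visits_def alive_def y_def node_paths_def PiE_def extensional_def fun_eq_iff)
  then have "(\<Sum>x\<in>node_paths n. indicator (visits n x) \<omega> :: real) =
      (\<Sum>x\<in>node_paths n. if x = y then 1 else 0)"
    by (intro sum.cong) (auto simp: indicator_def)
  also have "y \<in> node_paths n"
    by (simp add: y_def node_paths_def)
  then have "(\<Sum>x\<in>node_paths n. if x = y then 1 else 0 :: real) = 1"
    by simp
  finally show ?thesis
    using True by simp
next
  case False
  then have "\<omega> \<notin> visits n x" for x
    by (auto simp: alive_def visits_def)
  then show ?thesis
    using False by simp
qed

lemma prob_alive: "prob (alive n) = path_sum (\<lambda>_. 1) n (\<chi> j. 1)"
proof -
  have "prob (alive n) = expectation (indicator (alive n))"
    by simp
  also have "\<dots> = expectation (\<lambda>\<omega>. \<Sum>x\<in>node_paths n. indicator (visits n x) \<omega>)"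
    by (simp flip: indicator_alive)
  also have "\<dots> = path_sum (\<lambda>_. 1) n (\<chi> j. 1)"
    by (subst Bochner_Integration.integral_sum)
      (auto simp: path_sum_def integrable_indicator_iff emeasure_eq_measure)
  finally show ?thesis .
qed

text \<open>By \<open>path_sum_one\<close> the survival probability is the entry distribution paired
  with \<open>P\<^sup>n A\<close>.\<close>

lemma prob_alive_tendsto_0: "(\<lambda>n. prob (alive n)) \<longlonglongrightarrow> 0"
proof -
  have "(\<lambda>n. \<Sum>j\<in>UNIV. lam $ j / total_rate lam * 1 * (((*v) P ^^ n) (\<chi> j. 1)) $ j) \<longlonglongrightarrow> 0"
    using routing_nonneg exit_nonneg open_network
    by (intro tendsto_null_sum tendsto_mult_right_zero substochastic_powers_tendsto_0) auto
  then show ?thesis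
    by (simp add: prob_alive path_sum_one[where v = "\<chi> j. 1"] path_sum_0)
qed

lemma AE_eventually_exits: "AE \<omega> in M. \<exists>n. \<omega> \<notin> alive n"
proof (rule AE_I)
  have "prob (\<Inter>n. alive n) \<le> 0"
    by (intro LIMSEQ_le_const[OF prob_alive_tendsto_0] exI allI impI finite_measure_mono) auto
  then show "emeasure M (\<Inter>n. alive n) = 0"
    by (simp add: emeasure_eq_measure measure_le_0_iff)
qed auto

text \<open>Absorption is assumed only through transition probabilities. Each fixed history ending
  in \<open>None\<close> continues to a node with probability 0, and there are finitely many
  histories up to \<open>k\<close>.\<close>

lemma AE_outside_absorbing:
  "AE \<omega> in M. \<forall>k. route k \<omega> = None \<longrightarrow> route (Suc k) \<omega> = None"
  unfolding AE_all_countable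
proof
  fix k :: nat
  let ?H = "Pi\<^sub>E {..k} (\<lambda>_. UNIV :: 'n option set)"
  have "AE \<omega> in M. \<not> ((\<forall>i\<le>k. route i \<omega> = x i) \<and> route (Suc k) \<omega> = Some l)"
    if "x k = None" for x :: "nat \<Rightarrow> 'n option" and l
    using routing[of k x "Some l"] that
    by (intro AE_I[OF subset_refl]) (auto simp: emeasure_eq_measure)
  then have "AE \<omega> in M. \<forall>x\<in>?H. \<forall>l\<in>UNIV. x k = None \<longrightarrow>
      \<not> ((\<forall>i\<le>k. route i \<omega> = x i) \<and> route (Suc k) \<omega> = Some l)"
    by (intro AE_finite_allI) (auto intro: finite_PiE)
  then show "AE \<omega> in M. route k \<omega> = None \<longrightarrow> route (Suc k) \<omega> = None"
  proof eventually_elim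
    case (elim \<omega>)
    then show ?case
      using elim[rule_format, of "restrict (\<lambda>i. route i \<omega>) {..k}"]
      by (cases "route (Suc k) \<omega>") auto
  qed
qed

section \<open>The service times along the route\<close>

lemma AE_service_nonneg: "AE \<omega> in M. \<forall>k j. 0 \<le> serv k j \<omega>"
  unfolding AE_all_countable using service_nonneg by blast

lemma absorbed:
  assumes "\<forall>k. route k \<omega> = None \<longrightarrow> route (Suc k) \<omega> = None" "route k \<omega> = None" "k \<le> n"
  shows "route n \<omega> = None"
  using assms(3,1,2) by (induction rule: dec_induct) auto

text \<open>Almost surely the customer leaves and stays outside, so the series is a finite sum of
  nonnegative service times.\<close>

lemma AE_sojourn_time_nonneg: "AE \<omega> in M. 0 \<le> sojourn_time route serv \<omega>"
  using AE_eventually_exits AE_outside_absorbing AE_service_nonneg AE_space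
proof eventually_elim
  case (elim \<omega>)
  then obtain k where "route k \<omega> = None"
    by (auto simp: alive_def)
  then have "route n \<omega> = None" if "n \<notin> {..<k}" for n
    using absorbed[OF elim(2)] that by simp
  then have "sojourn_time route serv \<omega> =
      (\<Sum>n<k. case route n \<omega> of None \<Rightarrow> 0 | Some j \<Rightarrow> serv n j \<omega>)"
    unfolding sojourn_time_def by (intro suminf_finite) auto
  then show ?case
    using elim(3) by (auto intro!: sum_nonneg split: option.split)
qed

lemma sojourn_time_eq:
  assumes absorbing: "\<forall>k. route k \<omega> = None \<longrightarrow> route (Suc k) \<omega> = None"
    and x: "\<omega> \<in> visits n x" and exit: "route (Suc n) \<omega> = None"
  shows "sojourn_time route serv \<omega> = (\<Sum>i\<le>n. serv i (x i) \<omega>)"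
proof -
  have "route k \<omega> = None" if "k \<notin> {..n}" for k
    using absorbed[OF absorbing exit] that by simp
  then have "sojourn_time route serv \<omega> =
      (\<Sum>k\<le>n. case route k \<omega> of None \<Rightarrow> 0 | Some j \<Rightarrow> serv k j \<omega>)"
    unfolding sojourn_time_def by (intro suminf_finite) auto
  also have "\<dots> = (\<Sum>i\<le>n. serv i (x i) \<omega>)"
    using x by (intro sum.cong) (auto simp: visits_def)
  finally show ?thesis .
qed

lemma AE_exp_bounded:
  fixes X :: "'a \<Rightarrow> real"
  assumes "0 \<le> s" "AE \<omega> in M. 0 \<le> X \<omega>"
  shows "AE \<omega> in M. norm (exp (- s * X \<omega>)) \<le> 1"
  using assms(2) by eventually_elim (use assms(1) in auto)

lemma integrable_exp:
  fixes X :: "'a \<Rightarrow> real"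
  assumes "0 \<le> s" "AE \<omega> in M. 0 \<le> X \<omega>" and [measurable]: "X \<in> borel_measurable M"
  shows "integrable M (\<lambda>\<omega>. exp (- s * X \<omega>))"
  using AE_exp_bounded[OF assms(1,2)] by (intro integrable_const_bound[where B = 1]) auto

lemma service_laplace:
  "expectation (\<lambda>\<omega>. exp (- s * serv k j \<omega>)) = laplace_transform (G j) s"
  using laplace_transform_eq_expectation[OF service_measurable service_nonneg, of k j s]
  by (simp add: service_cdf)

lemma service_laplace_nonneg: "0 \<le> laplace_transform (G j) s"
  unfolding service_laplace[of s 0 j, symmetric] by simp

lemma service_laplace_le_1:
  assumes "0 \<le> s"
  shows "laplace_transform (G j) s \<le> 1"
proof -
  have "expectation (\<lambda>\<omega>. exp (- s * serv 0 j \<omega>)) \<le> expectation (\<lambda>_. 1)"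
    using AE_exp_bounded[OF assms service_nonneg] assms
    by (intro integral_mono_AE integrable_exp service_nonneg) auto
  then show ?thesis
    by (simp only: service_laplace) (simp add: prob_space)
qed

lemma path_services_product:
  assumes s: "0 \<le> s"
  shows "integrable M (\<lambda>\<omega>. \<Prod>i\<le>n. exp (- s * serv i (x i) \<omega>) :: real)" (is "integrable M ?Y")
    and "expectation (\<lambda>\<omega>. \<Prod>i\<le>n. exp (- s * serv i (x i) \<omega>)) =
      (\<Prod>i\<le>n. laplace_transform (G (x i)) s)"
proof -
  \<comment> \<open>The service number in the index keeps the pairs distinct even when
    \<open>x\<close> revisits a node, so the product runs over distinct independent
    variables.\<close>
  let ?I = "(\<lambda>i. (i, x i)) ` {..n}"
  let ?X = "\<lambda>kj \<omega>. exp (- s * (case kj of (k, j) \<Rightarrow> serv k j) \<omega>) :: real"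
  have inj: "inj_on (\<lambda>i. (i, x i)) {..n}"
    by (rule inj_onI) simp
  have indep: "indep_vars (\<lambda>_. borel) ?X ?I"
    using indep_vars_subset[OF services_indep, of ?I]
    by (intro indep_vars_compose2[where Y = "\<lambda>_ t. exp (- s * t)" and M' = "\<lambda>_. borel"]) auto
  have int: "integrable M (?X kj)" for kj
    by (cases kj) (auto intro!: integrable_exp[OF s service_nonneg, simplified])
  have Y: "?Y = (\<lambda>\<omega>. \<Prod>kj\<in>?I. ?X kj \<omega>)"
    by (simp add: prod.reindex[OF inj])
  show "integrable M ?Y"
    unfolding Y by (intro indep_vars_integrable indep int) simp
  show "expectation ?Y = (\<Prod>i\<le>n. laplace_transform (G (x i)) s)"
    unfolding Y
    by (subst indep_vars_lebesgue_integral[OF _ indep int])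
      (simp_all add: prod.reindex[OF inj] service_laplace[simplified])
qed

text \<open>The path \<open>x\<close> is fixed, so the product depends on the services alone and is
  independent of every event \<open>A\<close> determined by the route.\<close>

lemma expectation_path_services:
  assumes s: "0 \<le> s"
    and A: "A \<in> sets (vimage_algebra (space M) (\<lambda>\<omega> k. route k \<omega>)
      (\<Pi>\<^sub>M k\<in>UNIV. count_space UNIV))"
  shows "expectation (\<lambda>\<omega>. indicator A \<omega> * (\<Prod>i\<le>n. exp (- s * serv i (x i) \<omega>))) =
    prob A * (\<Prod>i\<le>n. laplace_transform (G (x i)) s)"
    (is "expectation (\<lambda>\<omega>. _ * ?Y \<omega>) = _")
    and "integrable M (\<lambda>\<omega>. indicator A \<omega> * (\<Prod>i\<le>n. exp (- s * serv i (x i) \<omega>)))"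
proof -
  let ?T = "\<Pi>\<^sub>M kj\<in>(UNIV :: (nat \<times> 'n) set). (borel :: real measure)"
  let ?S = "vimage_algebra (space M) (\<lambda>\<omega> (k, j). serv k j \<omega>) ?T"
  have "(\<lambda>\<omega> (k, j). serv k j \<omega>) \<in> measurable ?S ?T"
    by (intro measurable_vimage_algebra1) (auto simp: space_PiM)
  then have "(\<lambda>t. \<Prod>i\<le>n. exp (- s * t (i, x i))) \<circ> (\<lambda>\<omega> (k, j). serv k j \<omega>) \<in> borel_measurable ?S"
    by (rule measurable_comp) measurable
  then have "?Y \<in> borel_measurable ?S"
    by (simp add: comp_def)
  then have indep: "indep_var borel (indicator A :: _ \<Rightarrow> real) borel ?Y"
    using A by (intro indep_var_of_indep_set[OF services_indep_route]) auto
  have ev: "A \<in> sets M"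
    using A indep_setD_ev1[OF services_indep_route] by blast
  then have int_ind: "integrable M (indicator A :: _ \<Rightarrow> real)"
    by (simp add: integrable_indicator_iff emeasure_eq_measure)
  have int_Y: "integrable M ?Y"
    by (rule path_services_product(1)[OF s])
  show "expectation (\<lambda>\<omega>. indicator A \<omega> * ?Y \<omega>) =
      prob A * (\<Prod>i\<le>n. laplace_transform (G (x i)) s)"
    unfolding indep_var_lebesgue_integral[OF indep int_ind int_Y] path_services_product(2)[OF s]
    using ev by simp
  show "integrable M (\<lambda>\<omega>. indicator A \<omega> * ?Y \<omega>)"
    using integrable_mult_indicator[OF ev int_Y] by simp
qed

section \<open>The Laplace transform of the sojourn time\<close>

text \<open>This is \<open>R\<^sub>n\<close> of the overview; the exponent contains the whole
  sojourn time, not only the services up to \<open>n\<close>.\<close>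

definition alive_transform :: "real \<Rightarrow> nat \<Rightarrow> real" where
  "alive_transform s n =
    expectation (\<lambda>\<omega>. indicator (alive n) \<omega> * exp (- s * sojourn_time route serv \<omega>))"

text \<open>A customer alive at step \<open>n\<close> is either still alive at the next step or
  leaves after some path \<open>x\<close>. In the second case the sojourn time is almost surely the
  sum of the services along \<open>x\<close>, so the expectation factorizes.\<close>

lemma alive_transform_step:
  assumes s: "0 \<le> s"
  shows "alive_transform s n = alive_transform s (Suc n) +
    path_sum (\<lambda>j. laplace_transform (G j) s) n ((mat 1 - P) *v (\<chi> j. 1))"
proof -
  let ?E = "\<lambda>\<omega>. exp (- s * sojourn_time route serv \<omega>)"
  let ?D = "\<lambda>x. visits n x \<inter> {\<omega> \<in> space M. route (Suc n) \<omega> = None}"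
  let ?Y = "\<lambda>x \<omega>. \<Prod>i\<le>n. exp (- s * serv i (x i) \<omega>)"
  \<comment> \<open>Independence from the services requires membership in the sigma-algebra of the
    route, not merely in that of \<open>M\<close>.\<close>
  have D: "?D x \<in> sets (vimage_algebra (space M) (\<lambda>\<omega> k. route k \<omega>)
      (\<Pi>\<^sub>M k\<in>UNIV. count_space UNIV))" for x
  proof -
    let ?R = "\<Pi>\<^sub>M k\<in>(UNIV :: nat set). count_space (UNIV :: 'n option set)"
    let ?B = "{r \<in> space ?R. (\<forall>i\<le>n. r i = Some (x i)) \<and> r (Suc n) = None}"
    have "?D x = (\<lambda>\<omega> k. route k \<omega>) -` ?B \<inter> space M"
      by (auto simp: visits_def space_PiM)
    also have "\<dots> \<in> sets (vimage_algebra (space M) (\<lambda>\<omega> k. route k \<omega>) ?R)"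
      by (rule in_vimage_algebra) measurable
    finally show ?thesis .
  qed
  have int_E: "integrable M ?E"
    by (intro integrable_exp s AE_sojourn_time_nonneg) simp
  have ind_split: "indicator (alive n) \<omega> = indicator (alive (Suc n)) \<omega> +
      (\<Sum>x\<in>node_paths n. indicator (?D x) \<omega> :: real)" for \<omega>
  proof -
    have "(\<Sum>x\<in>node_paths n. indicator (?D x) \<omega> :: real) =
        indicator (alive n) \<omega> * indicator {\<omega> \<in> space M. route (Suc n) \<omega> = None} \<omega>"
      by (simp add: indicator_alive indicator_inter_arith sum_distrib_right)
    then show ?thesis
      by (auto simp: indicator_def alive_def le_Suc_eq)
  qed
  have AE_D: "AE \<omega> in M. \<forall>x. indicator (?D x) \<omega> * ?E \<omega> = indicator (?D x) \<omega> * ?Y x \<omega>"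
    using AE_outside_absorbing
  proof eventually_elim
    case (elim \<omega>)
    have E: "?E \<omega> = ?Y x \<omega>" if "\<omega> \<in> ?D x" for x
    proof -
      have "\<omega> \<in> visits n x" "route (Suc n) \<omega> = None"
        using that by auto
      then show ?thesis
        by (simp only: sojourn_time_eq[OF elim] sum_distrib_left exp_sum finite_atMost)
    qed
    have "indicator (?D x) \<omega> * ?E \<omega> = indicator (?D x) \<omega> * ?Y x \<omega>" for x
      by (cases "\<omega> \<in> ?D x") (simp_all only: E indicator_simps mult_zero_left simp_thms)
    then show ?case ..
  qed
  have D_ev: "?D x \<in> sets M" for x
    by (intro sets.Int sets_visits) measurable
  have int_alive: "integrable M (\<lambda>\<omega>. indicator (alive (Suc n)) \<omega> * ?E \<omega>)"
    using integrable_mult_indicator[OF sets_alive int_E] by simp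
  have int_D: "integrable M (\<lambda>\<omega>. indicator (?D x) \<omega> * ?E \<omega>)" for x
    using integrable_mult_indicator[OF D_ev int_E] by (simp only: real_scaleR_def)
  have "alive_transform s n = expectation (\<lambda>\<omega>. indicator (alive (Suc n)) \<omega> * ?E \<omega> +
      (\<Sum>x\<in>node_paths n. indicator (?D x) \<omega> * ?E \<omega>))"
    by (simp only: alive_transform_def ind_split distrib_right sum_distrib_right)
  also have "\<dots> = alive_transform s (Suc n) +
      (\<Sum>x\<in>node_paths n. expectation (\<lambda>\<omega>. indicator (?D x) \<omega> * ?E \<omega>))"
    by (simp only: alive_transform_def Bochner_Integration.integral_add
        Bochner_Integration.integral_sum Bochner_Integration.integrable_sum int_alive int_D)
  also have "(\<Sum>x\<in>node_paths n. expectation (\<lambda>\<omega>. indicator (?D x) \<omega> * ?E \<omega>)) =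
      (\<Sum>x\<in>node_paths n. prob (?D x) * (\<Prod>i\<le>n. laplace_transform (G (x i)) s))"
  proof (rule sum.cong[OF refl])
    fix x :: "nat \<Rightarrow> 'n"
    have "expectation (\<lambda>\<omega>. indicator (?D x) \<omega> * ?E \<omega>) = expectation (\<lambda>\<omega>. indicator (?D x) \<omega> * ?Y x \<omega>)"
    proof (rule integral_cong_AE)
      show "AE \<omega> in M. indicator (?D x) \<omega> * ?E \<omega> = indicator (?D x) \<omega> * ?Y x \<omega>"
        using AE_D by eventually_elim (erule spec)
      show "(\<lambda>\<omega>. indicator (?D x) \<omega> * ?E \<omega>) \<in> borel_measurable M"
        by (rule borel_measurable_integrable) (rule int_D)
      show "(\<lambda>\<omega>. indicator (?D x) \<omega> * ?Y x \<omega>) \<in> borel_measurable M"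
        by (rule borel_measurable_integrable) (rule expectation_path_services(2)[OF s D])
    qed
    then show "expectation (\<lambda>\<omega>. indicator (?D x) \<omega> * ?E \<omega>) =
        prob (?D x) * (\<Prod>i\<le>n. laplace_transform (G (x i)) s)"
      by (simp only: expectation_path_services(1)[OF s D])
  qed
  also have "(\<Sum>x\<in>node_paths n. prob (?D x) * (\<Prod>i\<le>n. laplace_transform (G (x i)) s)) =
      path_sum (\<lambda>j. laplace_transform (G j) s) n ((mat 1 - P) *v (\<chi> j. 1))"
    \<comment> \<open>The entry of \<open>(I - P) A\<close> at the last node is its exit
      probability.\<close>
    unfolding prob_visits_exit path_sum_def
    by (simp add: matrix_vector_mult_diff_rdistrib)
      (simp add: matrix_vector_mult_def exit_prob_def ac_simps)
  finally show ?thesis .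
qed

text \<open>The exponential is almost surely at most 1, so the survival probability is an upper
  bound.\<close>

lemma alive_transform_tendsto_0:
  assumes s: "0 \<le> s"
  shows "alive_transform s \<longlonglongrightarrow> 0"
proof (rule tendsto_sandwich[OF _ _ tendsto_const prob_alive_tendsto_0])
  let ?E = "\<lambda>\<omega>. exp (- s * sojourn_time route serv \<omega>)"
  have int_E: "integrable M ?E"
    by (intro integrable_exp s AE_sojourn_time_nonneg) simp
  have "integrable M (\<lambda>\<omega>. indicator (alive n) \<omega> * ?E \<omega>)" for n
    using integrable_mult_indicator[OF sets_alive int_E] by simp
  moreover have "AE \<omega> in M. indicator (alive n) \<omega> * ?E \<omega> \<le> indicator (alive n) \<omega>" for n
    using AE_exp_bounded[OF s AE_sojourn_time_nonneg]
    by eventually_elim (auto simp: indicator_def)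
  ultimately have "alive_transform s n \<le> expectation (indicator (alive n))" for n
    unfolding alive_transform_def
    by (intro integral_mono_AE) (auto simp: integrable_indicator_iff emeasure_eq_measure)
  then show "\<forall>\<^sub>F n in sequentially. alive_transform s n \<le> prob (alive n)"
    by simp
qed (simp add: alive_transform_def)

text \<open>The entry probabilities add up to 1, so restricting to \<open>alive 0\<close> changes
  nothing almost surely.\<close>

lemma alive_transform_0:
  "alive_transform s 0 = laplace_transform (cdf (distr M borel (sojourn_time route serv))) s"
proof -
  have "prob (alive 0) = 1"
    using total_rate_pos
    by (simp add: prob_alive path_sum_0 total_rate_def flip: sum_divide_distrib)
  then have "AE \<omega> in M. \<omega> \<in> alive 0"
    by (simp add: prob_eq_1)
  then have "alive_transform s 0 = expectation (\<lambda>\<omega>. exp (- s * sojourn_time route serv \<omega>))"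
    unfolding alive_transform_def by (intro integral_cong_AE) auto
  then show ?thesis
    by (simp add: laplace_transform_eq_expectation AE_sojourn_time_nonneg)
qed

lemma invertible_P_mat:
  assumes "0 \<le> s"
  shows "invertible (mat 1 - P_mat P G s)"
  using routing_nonneg exit_nonneg open_network
proof (rule invertible_dominated_substochastic)
  show "\<bar>P_mat P G s $ i $ j\<bar> \<le> P $ i $ j" for i j
    using routing_nonneg[of i j] service_laplace_nonneg[of j s] service_laplace_le_1[OF assms, of j]
    by (simp add: P_mat_def abs_mult mult_left_le)
qed

lemma sojourn_time_transform:
  assumes s: "0 \<le> s"
  shows "laplace_transform (cdf (distr M borel (sojourn_time route serv))) s =
    inverse (total_rate lam) *
      (Lambda_vec lam G s \<bullet> ((matrix_inv (mat 1 - P_mat P G s) ** (mat 1 - P)) *v (\<chi> j. 1)))"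
proof -
  define g where "g j = laplace_transform (G j) s" for j
  define q where "q = (mat 1 - P) *v (\<chi> j. 1)"
  define v where "v = matrix_inv (mat 1 - P_mat P G s) *v q"
  have "(mat 1 - P_mat P G s) *v v = q"
    unfolding v_def
    by (simp add: matrix_vector_mul_assoc matrix_mul_matrix_inv invertible_P_mat s)
  then have v: "v = P_mat P G s *v v + q"
    by (simp add: matrix_vector_mult_diff_rdistrib algebra_simps)
  have inv: "alive_transform s n - path_sum g n v = alive_transform s 0 - path_sum g 0 v" for n
  proof (induction n)
    case (Suc n)
    \<comment> \<open>Expand \<open>v\<close> by its fixed-point equation; the part
      \<open>P(s) v\<close> advances \<open>path_sum\<close> by one step.\<close>
    have "path_sum g n v = path_sum g (Suc n) v + path_sum g n q"
      by (subst v) (simp add: path_sum_add path_sum_Suc P_mat_def g_def)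
    moreover have "alive_transform s n = alive_transform s (Suc n) + path_sum g n q"
      using alive_transform_step[OF s, of n] by (simp add: g_def[abs_def] q_def)
    ultimately show ?case
      using Suc by simp
  qed simp
  have "(\<lambda>n. path_sum g n v) \<longlonglongrightarrow> 0"
  proof (rule Lim_null_comparison)
    show "\<forall>\<^sub>F n in sequentially. norm (path_sum g n v) \<le> norm v * prob (alive n)"
      using abs_path_sum_le[of g] service_laplace_nonneg service_laplace_le_1[OF s]
      by (simp add: prob_alive g_def)
    show "(\<lambda>n. norm v * prob (alive n)) \<longlonglongrightarrow> 0"
      by (intro tendsto_mult_right_zero prob_alive_tendsto_0)
  qed
  then have "(\<lambda>n. alive_transform s n - path_sum g n v) \<longlonglongrightarrow> 0 - 0"
    by (intro tendsto_diff alive_transform_tendsto_0 s)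
  moreover have "(\<lambda>n. alive_transform s n - path_sum g n v) =
      (\<lambda>_. alive_transform s 0 - path_sum g 0 v)"
    by (rule ext) (rule inv)
  \<comment> \<open>A constant sequence with limit 0 is 0.\<close>
  ultimately have "alive_transform s 0 = path_sum g 0 v"
    by (simp add: LIMSEQ_const_iff)
  also have "\<dots> = inverse (total_rate lam) * (Lambda_vec lam G s \<bullet> v)"
    by (simp add: path_sum_0 Lambda_vec_def inner_vec_def g_def sum_distrib_left divide_inverse
        ac_simps)
  finally show ?thesis
    by (simp add: alive_transform_0 v_def q_def matrix_vector_mul_assoc)
qed

end

theorem mainTheorem1:
  fixes M :: "'a measure"
    and lam :: "real^'n"
    and P :: "real^'n^'n"
    and G :: "'n \<Rightarrow> real \<Rightarrow> real"
    and route :: "nat \<Rightarrow> 'a \<Rightarrow> 'n option"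
    and serv :: "nat \<Rightarrow> 'n \<Rightarrow> 'a \<Rightarrow> real"
    and s :: real
  assumes "infinite_server_network M lam P G route serv"
    and "0 \<le> s"
  shows "invertible (mat 1 - P_mat P G s) \<and>
    laplace_transform (cdf (distr M borel (sojourn_time route serv))) s =
      inverse (total_rate lam) *
        (Lambda_vec lam G s \<bullet>
          ((matrix_inv (mat 1 - P_mat P G s) ** (mat 1 - P)) *v (\<chi> j. 1)))"
  using infinite_server_network.invertible_P_mat[OF assms]
    infinite_server_network.sojourn_time_transform[OF assms]
  by blast

end
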